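(* (1) Let $n\ge5$ be odd. If $A\in\mathcal S^n$ has support graph $G(A)=C_n$ (the $n$-cycle) and rank $n-2$, then $A$ is not completely positive semidefinite. (2) If $A\in\mathcal S^5$ lies on an extreme ray of the cone $\mathcal{DNN}^5$, then $A$ is completely positive semidefinite if and only if $A$ is completely positive.
   Context: $\mathcal S^d$ denotes the real symmetric $d\times d$ matrices with trace inner product $\langle X,Y\rangle=\mathrm{Tr}(XY)$, and $\mathcal S^d_+$ the positive semidefinite ones. The support graph $G(A)$ of $A\in\mathcal S^n$ has vertex set $\{1,\dots,n\}$ and an edge $\{i,j\}$ ($i\ne j$) exactly when $A_{ij}\neq0$; $G(A)=C_n$ means that $G(A)$ is a cycle of length $n$. $A\in\mathcal S^n$ is completely positive semidefinite if there exist $d\ge1$ and $X_1,\dots,X_n\in\mathcal S^d_+$ with $A_{ij}=\langle X_i,X_j\rangle$ for all $i,j$; it is completely positive if there exist $d\ge1$ and entrywise nonnegative vectors $x_1,\dots,x_n\in\mathbb R^d_+$ with $A_{ij}=x_i^Tx_j$ for all $i,j$. $\mathcal{DNN}^n$ is the cone of positive semidefinite matrices in $\mathcal S^n$ with nonnegative entries. *)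

theory Defs
  imports "Jordan_Normal_Form.DL_Rank"
begin

text \<open>Rows and columns of a matrix, and hence the vertices of a support graph, are numbered
  \<open>0, \<dots>, n - 1\<close>.\<close>

definition sym_mats :: "nat \<Rightarrow> real mat set" where
  "sym_mats n = {A \<in> carrier_mat n n. transpose_mat A = A}"

definition psd_mats :: "nat \<Rightarrow> real mat set" where
  "psd_mats n = {A \<in> sym_mats n. \<forall>v \<in> carrier_vec n. 0 \<le> v \<bullet> (A *\<^sub>v v)}"

definition mat_trace :: "real mat \<Rightarrow> real" where
  "mat_trace A = (\<Sum>i<dim_row A. A $$ (i, i))"

definition trace_inner :: "real mat \<Rightarrow> real mat \<Rightarrow> real" where
  "trace_inner X Y = mat_trace (X * Y)"

definition cpsd_mats :: "nat \<Rightarrow> real mat set" where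
  "cpsd_mats n = {A \<in> sym_mats n. \<exists>d\<ge>1. \<exists>X :: nat \<Rightarrow> real mat.
     (\<forall>i<n. X i \<in> psd_mats d) \<and>
     (\<forall>i<n. \<forall>j<n. A $$ (i, j) = trace_inner (X i) (X j))}"

definition cp_mats :: "nat \<Rightarrow> real mat set" where
  "cp_mats n = {A \<in> sym_mats n. \<exists>d\<ge>1. \<exists>x :: nat \<Rightarrow> real vec.
     (\<forall>i<n. x i \<in> carrier_vec d \<and> (\<forall>k<d. 0 \<le> x i $ k)) \<and>
     (\<forall>i<n. \<forall>j<n. A $$ (i, j) = x i \<bullet> x j)}"

definition dnn_mats :: "nat \<Rightarrow> real mat set" where
  "dnn_mats n = {A \<in> psd_mats n. \<forall>i<n. \<forall>j<n. 0 \<le> A $$ (i, j)}"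

definition support_edges :: "real mat \<Rightarrow> nat set set" where
  "support_edges A =
     {{i, j} | i j. i < dim_row A \<and> j < dim_row A \<and> i \<noteq> j \<and> A $$ (i, j) \<noteq> 0}"

text \<open>The vertices may be visited in any order \<open>v 0, \<dots>, v (n - 1)\<close>. As \<open>n \<ge> 3\<close>, there are \<open>n\<close>
  distinct edges and no loops.\<close>

definition is_cycle_graph :: "nat \<Rightarrow> nat set set \<Rightarrow> bool" where
  "is_cycle_graph n E \<longleftrightarrow> 3 \<le> n \<and>
     (\<exists>v. bij_betw v {..<n} {..<n} \<and> E = {{v i, v (Suc i mod n)} | i. i < n})"

text \<open>The type of matrices of all formats is not a vector space, so \<open>face_of\<close> from
  HOL-Analysis is not available. For a convex cone \<open>K\<close> of matrices of one format, an extreme ray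
  is a one-dimensional face: a ray generated by a nonzero element of \<open>K\<close> that contains both
  summands of each of its points that is a sum of two elements of \<open>K\<close>.\<close>

definition extreme_ray :: "real mat set \<Rightarrow> real mat set \<Rightarrow> bool" where
  "extreme_ray K R \<longleftrightarrow>
     (\<exists>B \<in> K. B \<noteq> 0\<^sub>m (dim_row B) (dim_col B) \<and> R = {t \<cdot>\<^sub>m B | t. 0 \<le> t}) \<and>
     (\<forall>X \<in> K. \<forall>Y \<in> K. X + Y \<in> R \<longrightarrow> X \<in> R \<and> Y \<in> R)"

end

theory Submission
  imports Defs
begin

text \<open>Let \<open>A\<close> be the Gram matrix of positive semidefinite \<open>X i\<close>; then \<open>A i j = 0\<close> forces
  \<open>X i * X j = 0\<close>.

  (1) As \<open>A\<close> has corank at least 2, some \<open>w \<noteq> 0\<close> with \<open>w\<^sup>T A w = 0\<close> vanishes at a prescribed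
  vertex; then \<open>\<Sum>i. w i X i = 0\<close>. Walking along the cycle, \<open>w j = 0\<close> and \<open>w k \<noteq> 0\<close> for some adjacent
  \<open>j\<close>, \<open>k\<close>. No third vertex is adjacent to both, so \<open>0 = X j (\<Sum>i. w i X i) X k = w k X j (X k)\<^sup>2\<close>,
  whence \<open>X j * X k = 0\<close> and \<open>A j k = 0\<close>, a contradiction.

  (2) For every \<open>P\<close> the matrix \<open>M i j = Tr (P (X i X j + X j X i))\<close> vanishes wherever \<open>A\<close> does, and
  its quadratic form is bounded by a multiple of that of \<open>A\<close>. If \<open>A\<close> is extremal, then
  \<open>M\<close> is a multiple of \<open>A\<close>. Varying \<open>P\<close>, the matrices \<open>(X i)\<^sup>2\<close> are proportional to the numbers \<open>A i i\<close>;
  by uniqueness of positive semidefinite square roots so are the \<open>X i\<close> to \<open>sqrt (A i i)\<close>, hence \<open>A\<close>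
  has rank at most 1.\<close>

section \<open>Symmetric matrices, quadratic forms and the trace inner product\<close>

lemma sym_matsD:
  assumes "A \<in> sym_mats n"
  shows "A \<in> carrier_mat n n" "transpose_mat A = A" "dim_row A = n" "dim_col A = n"
  using assms by (auto simp: sym_mats_def)

lemma sym_mats_entry:
  assumes "A \<in> sym_mats n" "i < n" "j < n"
  shows "A $$ (i, j) = A $$ (j, i)"
  using assms by (metis carrier_matD index_transpose_mat(1) sym_matsD(1,2))

lemma sym_matsI:
  assumes "A \<in> carrier_mat n n" "\<And>i j. i < n \<Longrightarrow> j < n \<Longrightarrow> A $$ (i, j) = A $$ (j, i)"
  shows "A \<in> sym_mats n"
  using assms by (auto simp: sym_mats_def intro!: eq_matI)

lemma psd_mats_sym: "A \<in> psd_mats n \<Longrightarrow> A \<in> sym_mats n"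
  by (simp add: psd_mats_def)

lemma psd_mats_form_nonneg: "A \<in> psd_mats n \<Longrightarrow> v \<in> carrier_vec n \<Longrightarrow> 0 \<le> v \<bullet> (A *\<^sub>v v)"
  by (simp add: psd_mats_def)

lemma form_eq_sum:
  fixes A :: "real mat"
  assumes "A \<in> carrier_mat n n" "v \<in> carrier_vec n"
  shows "v \<bullet> (A *\<^sub>v v) = (\<Sum>i<n. \<Sum>j<n. v $ i * v $ j * A $$ (i, j))"
  using assms by (auto simp: scalar_prod_def sum_distrib_left lessThan_atLeast0 mult_ac intro!: sum.cong)

lemma trace_inner_eq_sum:
  assumes "X \<in> carrier_mat m n" "Y \<in> carrier_mat n m"
  shows "trace_inner X Y = (\<Sum>a<m. \<Sum>b<n. X $$ (a, b) * Y $$ (b, a))"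
  using assms by (auto simp: trace_inner_def mat_trace_def scalar_prod_def lessThan_atLeast0
      intro!: sum.cong)

lemma trace_inner_commute:
  assumes "X \<in> carrier_mat m n" "Y \<in> carrier_mat n m"
  shows "trace_inner X Y = trace_inner Y X"
  unfolding trace_inner_eq_sum[OF assms] trace_inner_eq_sum[OF assms(2,1)]
  by (subst sum.swap) (simp add: mult.commute)

lemma trace_inner_assoc:
  assumes "X \<in> carrier_mat n n" "Y \<in> carrier_mat n n" "Z \<in> carrier_mat n n"
  shows "trace_inner (X * Y) Z = trace_inner X (Y * Z)"
  using assms by (simp add: trace_inner_def)

lemma trace_inner_cyclic:
  assumes "X \<in> carrier_mat n n" "Y \<in> carrier_mat n n" "Z \<in> carrier_mat n n"
  shows "trace_inner X (Y * Z) = trace_inner Y (Z * X)"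
  using assms by (metis mult_carrier_mat trace_inner_assoc trace_inner_commute)

lemma trace_inner_diff_left:
  assumes "X \<in> carrier_mat n n" "Y \<in> carrier_mat n n" "Z \<in> carrier_mat n n"
  shows "trace_inner (X - Y) Z = trace_inner X Z - trace_inner Y Z"
  using assms by (simp add: trace_inner_eq_sum[of _ n n] sum_subtractf left_diff_distrib minus_carrier_mat)

lemma trace_inner_smult_left:
  assumes "X \<in> carrier_mat n n" "Y \<in> carrier_mat n n"
  shows "trace_inner (c \<cdot>\<^sub>m X) Y = c * trace_inner X Y"
  using assms by (simp add: trace_inner_eq_sum[of _ n n] sum_distrib_left algebra_simps)

lemma trace_inner_smult_right:
  assumes "X \<in> carrier_mat n n" "Y \<in> carrier_mat n n"
  shows "trace_inner X (c \<cdot>\<^sub>m Y) = c * trace_inner X Y"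
  using assms by (simp add: trace_inner_eq_sum[of _ n n] sum_distrib_left algebra_simps)

lemma trace_inner_zero:
  assumes "X \<in> carrier_mat n n"
  shows "trace_inner X (0\<^sub>m n n) = 0" "trace_inner (0\<^sub>m n n) X = 0"
  using assms by (simp_all add: trace_inner_eq_sum[of _ n n])

text \<open>This is the squared Frobenius norm. Most matrices below are shown to be 0 by showing
  that this trace vanishes.\<close>

lemma trace_inner_transpose:
  assumes "X \<in> carrier_mat n n"
  shows "trace_inner X (transpose_mat X) = (\<Sum>a<n. \<Sum>b<n. (X $$ (a, b))\<^sup>2)"
  using assms by (simp add: trace_inner_eq_sum[of _ n n] power2_eq_square)

lemma trace_inner_transpose_eq_0D:
  assumes "X \<in> carrier_mat n n" "trace_inner X (transpose_mat X) = 0"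
  shows "X = 0\<^sub>m n n"
proof -
  have "X $$ (a, b) = 0" if "a < n" "b < n" for a b
    using assms that by (auto simp: trace_inner_transpose sum_nonneg_eq_0_iff sum_nonneg)
  then show ?thesis using assms by (auto intro!: eq_matI)
qed

lemma trace_inner_self_eq_0D:
  assumes "X \<in> sym_mats n" "trace_inner X X = 0"
  shows "X = 0\<^sub>m n n"
  using trace_inner_transpose_eq_0D[of X n] assms by (simp add: sym_mats_def)

section \<open>Positive semidefinite matrices: null vectors, Schur complements, products of trace
  zero\<close>

lemma self_scalar_prod:
  fixes v :: "real vec"
  shows "0 \<le> v \<bullet> v" "v \<in> carrier_vec n \<Longrightarrow> v \<bullet> v = 0 \<Longrightarrow> v = 0\<^sub>v n"
  by (auto simp: scalar_prod_def sum_nonneg sum_nonneg_eq_0_iff intro!: eq_vecI)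

text \<open>With \<open>u = Y *\<^sub>v v\<close>, the form at \<open>v + t u\<close> is
  \<open>2 t (u \<bullet> u) + t\<^sup>2 q\<close>, where \<open>q\<close> is the form at
  \<open>u\<close>. If \<open>u\<close> were nonzero, this would be negative for small negative
  \<open>t\<close>.\<close>

lemma psd_mats_form_eq_0D:
  assumes Y: "Y \<in> psd_mats n" and v: "v \<in> carrier_vec n" and 0: "v \<bullet> (Y *\<^sub>v v) = 0"
  shows "Y *\<^sub>v v = 0\<^sub>v n"
proof -
  note YC = sym_matsD[OF psd_mats_sym[OF Y]]
  define u where "u = Y *\<^sub>v v"
  have u: "u \<in> carrier_vec n" using YC v by (simp add: u_def)
  have vu: "v \<bullet> (Y *\<^sub>v u) = u \<bullet> u"
    using transpose_vec_mult_scalar[OF YC(1) u v] u v YC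
    by (simp add: u_def)
  have key: "0 \<le> 2 * t * (u \<bullet> u) + t\<^sup>2 * (u \<bullet> (Y *\<^sub>v u))" for t
  proof -
    have "0 \<le> (v + t \<cdot>\<^sub>v u) \<bullet> (Y *\<^sub>v (v + t \<cdot>\<^sub>v u))"
      using u v by (intro psd_mats_form_nonneg[OF Y]) auto
    also have "Y *\<^sub>v (v + t \<cdot>\<^sub>v u) = u + t \<cdot>\<^sub>v (Y *\<^sub>v u)"
      using u v YC by (simp add: u_def mult_add_distrib_mat_vec mult_mat_vec)
    also have "(v + t \<cdot>\<^sub>v u) \<bullet> (u + t \<cdot>\<^sub>v (Y *\<^sub>v u))
        = v \<bullet> u + t * (v \<bullet> (Y *\<^sub>v u)) + t * (u \<bullet> u) + t\<^sup>2 * (u \<bullet> (Y *\<^sub>v u))"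
      using u v YC
      by (simp add: add_scalar_prod_distrib[of _ n] scalar_prod_add_distrib[of _ n] power2_eq_square
          distrib_left)
    finally show ?thesis using vu 0 by (simp add: u_def)
  qed
  have uu: "0 \<le> u \<bullet> u" by (rule self_scalar_prod(1))
  define q where "q = u \<bullet> (Y *\<^sub>v u)"
  have q: "q \<ge> 0" unfolding q_def by (rule psd_mats_form_nonneg[OF Y u])
  have "u \<bullet> u = 0"
  proof (rule ccontr)
    assume "u \<bullet> u \<noteq> 0"
    define s where "s = u \<bullet> u"
    have s: "s > 0" using \<open>u \<bullet> u \<noteq> 0\<close> uu by (simp add: s_def)
    \<comment> \<open>Keeping \<open>s\<close> in the denominator covers \<open>q = 0\<close> too.
      Since \<open>r * q = s - r * s\<close>, the value at \<open>t = - r\<close> is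
      \<open>- r s - r\<^sup>2 s\<close>, which is negative.\<close>
    define r where "r = s / (q + s)"
    have r: "r > 0" and "r * (q + s) = s" using s q by (auto simp: r_def)
    then have "r * q = s - r * s" by (simp add: algebra_simps)
    then have "r\<^sup>2 * q = r * (s - r * s)" by (simp add: power2_eq_square)
    moreover have "0 \<le> 2 * (- r) * s + (- r)\<^sup>2 * q"
      using key[of "- r"] by (simp add: q_def s_def)
    ultimately have "0 \<le> - (r * s) - r * r * s" by (simp add: algebra_simps)
    moreover have "r * s > 0" "r * r * s > 0" using r s by auto
    ultimately show False by simp
  qed
  then show ?thesis using u self_scalar_prod(2) by (simp add: u_def)
qed


text \<open>A zero diagonal entry makes the unit vector a zero of the form, so
  \<open>psd_mats_form_eq_0D\<close> annihilates the whole column.\<close>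

lemma psd_mats_diag:
  assumes X: "X \<in> psd_mats n" and i: "i < n"
  shows "0 \<le> X $$ (i, i)" "X $$ (i, i) = 0 \<Longrightarrow> j < n \<Longrightarrow> X $$ (j, i) = 0"
proof -
  note XC = sym_matsD[OF psd_mats_sym[OF X]]
  have e: "X *\<^sub>v unit_vec n i = col X i" using XC i by (auto intro!: eq_vecI)
  have f: "unit_vec n i \<bullet> (X *\<^sub>v unit_vec n i) = X $$ (i, i)" unfolding e using XC i by simp
  show "0 \<le> X $$ (i, i)" using psd_mats_form_nonneg[OF X, of "unit_vec n i"] f by simp
  assume "X $$ (i, i) = 0" "j < n"
  then have "col X i = 0\<^sub>v n" using psd_mats_form_eq_0D[OF X, of "unit_vec n i"] f e by simp
  then have "col X i $ j = 0" using \<open>j < n\<close> by simp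
  then show "X $$ (j, i) = 0" using XC i \<open>j < n\<close> by simp
qed

text \<open>The form of the Schur complement at \<open>v\<close> is the minimum over
  \<open>t\<close> of the form of \<open>X\<close> at \<open>v + t e\<close>, where \<open>e\<close>
  is the \<open>i\<close>-th unit vector. The minimum is attained at \<open>t = - s / p\<close> and
  is nonnegative because \<open>X\<close> is positive semidefinite.\<close>

lemma psd_mats_schur:
  assumes X: "X \<in> psd_mats n" and i: "i < n" and pos: "X $$ (i, i) \<noteq> 0"
  shows "mat n n (\<lambda>(a, b). X $$ (a, b) - X $$ (a, i) * X $$ (b, i) / X $$ (i, i)) \<in> psd_mats n"
    (is "?X' \<in> _")
  unfolding psd_mats_def mem_Collect_eq
proof (intro conjI ballI)
  note XC = sym_matsD[OF psd_mats_sym[OF X]]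
  note sym = sym_mats_entry[OF psd_mats_sym[OF X]]
  show "?X' \<in> sym_mats n" by (rule sym_matsI) (auto simp: sym)
  fix v :: "real vec" assume v: "v \<in> carrier_vec n"
  define p where "p = X $$ (i, i)"
  define s where "s = (\<Sum>a<n. v $ a * X $$ (a, i))"
  have e: "X *\<^sub>v unit_vec n i = col X i" using XC i by (auto intro!: eq_vecI)
  have col: "col X i \<in> carrier_vec n" using XC i by auto
  have vcol: "v \<bullet> col X i = s"
    using XC i v by (auto simp: s_def scalar_prod_def lessThan_atLeast0)
  have ev: "unit_vec n i \<bullet> (X *\<^sub>v v) = s"
    using XC i v vcol by (metis col comm_scalar_prod e transpose_vec_mult_scalar unit_vec_carrier)
  have ee: "unit_vec n i \<bullet> col X i = p" using XC i by (simp add: p_def)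
  define t where "t = - (s / p)"
  have "0 \<le> (v + t \<cdot>\<^sub>v unit_vec n i) \<bullet> (X *\<^sub>v (v + t \<cdot>\<^sub>v unit_vec n i))"
    using v by (intro psd_mats_form_nonneg[OF X]) auto
  also have "X *\<^sub>v (v + t \<cdot>\<^sub>v unit_vec n i) = X *\<^sub>v v + t \<cdot>\<^sub>v col X i"
    using v XC e by (simp add: mult_add_distrib_mat_vec[of _ n n] mult_mat_vec[of _ n n])
  also have "(v + t \<cdot>\<^sub>v unit_vec n i) \<bullet> (X *\<^sub>v v + t \<cdot>\<^sub>v col X i)
      = v \<bullet> (X *\<^sub>v v) + t * (v \<bullet> col X i) + t * (unit_vec n i \<bullet> (X *\<^sub>v v))
        + t * (t * (unit_vec n i \<bullet> col X i))"
    using v XC col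
    by (simp add: add_scalar_prod_distrib[of _ n] scalar_prod_add_distrib[of _ n] distrib_left
        del: scalar_prod_left_unit)
  also have "\<dots> = v \<bullet> (X *\<^sub>v v) - s * s / p"
    using pos unfolding vcol ev ee t_def p_def by (simp add: field_simps)
  also have "\<dots> = v \<bullet> (?X' *\<^sub>v v)"
  proof -
    have "v \<bullet> (?X' *\<^sub>v v) = (\<Sum>a<n. \<Sum>b<n. v $ a * v $ b * X $$ (a, b)
        - (v $ a * X $$ (a, i)) * (v $ b * X $$ (b, i)) / p)"
      using v by (subst form_eq_sum[of _ n]) (auto simp: p_def algebra_simps intro!: sum.cong)
    also have "\<dots> = v \<bullet> (X *\<^sub>v v) - s * s / p"
      using v XC by (simp add: form_eq_sum[of _ n] sum_subtractf s_def sum_product sum_divide_distrib)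
    finally show ?thesis by simp
  qed
  finally show "0 \<le> v \<bullet> (?X' *\<^sub>v v)" .
qed

text \<open>The induction is on the number of nonzero diagonal entries of \<open>X\<close>: a Schur complement splits off
  a rank-one summand \<open>x x\<^sup>T / X i i\<close>, which contributes \<open>x\<^sup>T Y x / X i i\<close> to the trace.\<close>

lemma trace_inner_psd:
  assumes "X \<in> psd_mats n" and Y: "Y \<in> psd_mats n"
  shows "0 \<le> trace_inner X Y \<and> (trace_inner X Y = 0 \<longrightarrow> X * Y = 0\<^sub>m n n)"
  using assms(1)
proof (induction "card {i. i < n \<and> X $$ (i, i) \<noteq> 0}" arbitrary: X rule: less_induct)
  case (less X)
  note X = less.prems
  note XC = sym_matsD[OF psd_mats_sym[OF X]]
  note YC = sym_matsD[OF psd_mats_sym[OF Y]]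
  show ?case
  proof (cases "\<exists>i<n. X $$ (i, i) \<noteq> 0")
    case False
    then have "X = 0\<^sub>m n n"
      using XC psd_mats_diag(2)[OF X] by (auto intro!: eq_matI)
    then show ?thesis using YC by (simp add: trace_inner_zero)
  next
    case True
    then obtain i where i: "i < n" and pos: "X $$ (i, i) \<noteq> 0" by blast
    define p where "p = X $$ (i, i)"
    have p: "p > 0" using psd_mats_diag(1)[OF X i] pos by (simp add: p_def)
    define X' where "X' = mat n n (\<lambda>(a, b). X $$ (a, b) - X $$ (a, i) * X $$ (b, i) / X $$ (i, i))"
    have X': "X' \<in> psd_mats n" unfolding X'_def by (rule psd_mats_schur[OF X i pos])
    note XC' = sym_matsD[OF psd_mats_sym[OF X']]
    \<comment> \<open>The induction measure drops: a zero diagonal entry of \<open>X\<close> stays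
      zero because its column vanishes, and the entry at \<open>i\<close> becomes zero.\<close>
    have "X' $$ (j, j) = 0" if "j < n" "X $$ (j, j) = 0" for j
      using that psd_mats_diag(2)[OF X that] sym_mats_entry[OF psd_mats_sym[OF X]] i
      by (simp add: X'_def)
    moreover have "X' $$ (i, i) = 0" using i pos by (simp add: X'_def)
    ultimately have "{j. j < n \<and> X' $$ (j, j) \<noteq> 0} \<subset> {j. j < n \<and> X $$ (j, j) \<noteq> 0}"
      using i pos by blast
    then have IH: "0 \<le> trace_inner X' Y" "trace_inner X' Y = 0 \<Longrightarrow> X' * Y = 0\<^sub>m n n"
      using less.hyps[of X'] X' by (auto simp: psubset_card_mono)
    define x where "x = col X i"
    have x: "x \<in> carrier_vec n" using XC i by (auto simp: x_def)
    have Xab: "X $$ (a, b) = X' $$ (a, b) + x $ a * x $ b / p" if "a < n" "b < n" for a b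
      using that XC i by (simp add: X'_def x_def p_def)
    have tr: "trace_inner X Y = trace_inner X' Y + x \<bullet> (Y *\<^sub>v x) / p"
    proof -
      have "trace_inner X Y = (\<Sum>a<n. \<Sum>b<n. X' $$ (a, b) * Y $$ (b, a)
            + x $ a * x $ b * Y $$ (a, b) / p)"
        using XC YC sym_mats_entry[OF psd_mats_sym[OF Y]]
        by (subst trace_inner_eq_sum[of _ n n]) (auto simp: Xab algebra_simps intro!: sum.cong)
      then show ?thesis
        using XC' YC x
        by (simp add: trace_inner_eq_sum[of _ n n] form_eq_sum[of _ n] sum.distrib sum_divide_distrib)
    qed
    have form: "0 \<le> x \<bullet> (Y *\<^sub>v x)" by (rule psd_mats_form_nonneg[OF Y x])
    have "X * Y = 0\<^sub>m n n" if "trace_inner X Y = 0"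
    proof -
      have "x \<bullet> (Y *\<^sub>v x) / p \<ge> 0" using form p by simp
      \<comment> \<open>Two nonnegative summands with sum 0. Both resulting zeros are needed:
        \<open>X * Y\<close> is \<open>X' * Y\<close> plus the rank-one matrix with entries
        \<open>x $ a / p * (Y *\<^sub>v x) $ b\<close>.\<close>
      then have "trace_inner X' Y = 0" "x \<bullet> (Y *\<^sub>v x) / p = 0" using that tr IH(1) by linarith+
      then have X'Y: "X' * Y = 0\<^sub>m n n" and Yx: "Y *\<^sub>v x = 0\<^sub>v n"
        using IH(2) psd_mats_form_eq_0D[OF Y x] p by auto
      have "(X * Y) $$ (a, b) = 0" if "a < n" "b < n" for a b
      proof -
        have "(X * Y) $$ (a, b) = (\<Sum>k<n. X' $$ (a, k) * Y $$ (k, b) + x $ a / p * (Y $$ (b, k) * x $ k))"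
          using that XC YC sym_mats_entry[OF psd_mats_sym[OF Y]]
          by (auto simp: scalar_prod_def lessThan_atLeast0 Xab algebra_simps intro!: sum.cong)
        also have "\<dots> = (X' * Y) $$ (a, b) + x $ a / p * (Y *\<^sub>v x) $ b"
          using that XC' YC x
          by (auto simp: scalar_prod_def lessThan_atLeast0 sum.distrib sum_distrib_left)
        finally show ?thesis using that X'Y Yx by simp
      qed
      then show ?thesis using XC YC by (auto intro!: eq_matI)
    qed
    then show ?thesis using tr form IH(1) p by simp
  qed
qed

lemma trace_inner_psd_eq_0D:
  assumes "X \<in> psd_mats n" "Y \<in> psd_mats n" "trace_inner X Y = 0"
  shows "X * Y = 0\<^sub>m n n"
  using trace_inner_psd assms by blast


section \<open>Linear combinations of matrices and Gram matrices\<close>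

text \<open>The sum is taken entry by entry because matrices of all formats share one type; this
  also fixes the format when \<open>n = 0\<close>.\<close>

definition mat_lincomb :: "nat \<Rightarrow> nat \<Rightarrow> (nat \<Rightarrow> real) \<Rightarrow> (nat \<Rightarrow> real mat) \<Rightarrow> real mat" where
  "mat_lincomb d n w X = mat d d (\<lambda>(a, b). \<Sum>i<n. w i * X i $$ (a, b))"

lemma mat_lincomb_carrier [simp]: "mat_lincomb d n w X \<in> carrier_mat d d"
  by (simp add: mat_lincomb_def)

lemma mat_lincomb_sym:
  assumes "\<And>i. i < n \<Longrightarrow> X i \<in> sym_mats d"
  shows "mat_lincomb d n w X \<in> sym_mats d"
  by (intro sym_matsI) (auto simp: mat_lincomb_def sym_mats_entry[OF assms] intro!: sum.cong)

lemma trace_inner_mat_lincomb: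
  assumes "Q \<in> carrier_mat d d" "\<And>i. i < n \<Longrightarrow> X i \<in> carrier_mat d d"
  shows "trace_inner Q (mat_lincomb d n w X) = (\<Sum>i<n. w i * trace_inner Q (X i))"
proof -
  have "trace_inner Q (mat_lincomb d n w X)
      = (\<Sum>a<d. \<Sum>b<d. \<Sum>i<n. w i * (Q $$ (a, b) * X i $$ (b, a)))"
    using assms
    by (simp add: trace_inner_eq_sum[of _ d d] mat_lincomb_def sum_distrib_left mult_ac)
  also have "\<dots> = (\<Sum>a<d. \<Sum>i<n. \<Sum>b<d. w i * (Q $$ (a, b) * X i $$ (b, a)))"
    by (intro sum.cong refl sum.swap)
  also have "\<dots> = (\<Sum>i<n. \<Sum>a<d. \<Sum>b<d. w i * (Q $$ (a, b) * X i $$ (b, a)))"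
    by (rule sum.swap)
  also have "\<dots> = (\<Sum>i<n. w i * trace_inner Q (X i))"
    using assms by (simp add: trace_inner_eq_sum[of _ d d] sum_distrib_left)
  finally show ?thesis .
qed

text \<open>Cyclicity brings one factor at a time into the last slot, where the trace is linear.
  Taking \<open>P\<close> to be the identity gives the form of the Gram matrix; general
  \<open>P\<close> serves the extremality argument.\<close>

lemma trace_inner_mat_lincomb_square:
  assumes P: "P \<in> carrier_mat d d" and X: "\<And>i. i < n \<Longrightarrow> X i \<in> carrier_mat d d"
  shows "trace_inner P (mat_lincomb d n w X * mat_lincomb d n w X)
    = (\<Sum>i<n. \<Sum>j<n. w i * w j * trace_inner P (X i * X j))"
proof -
  let ?W = "mat_lincomb d n w X"
  have "trace_inner P (?W * ?W) = trace_inner (?W * P) ?W"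
    using P by (metis mat_lincomb_carrier trace_inner_assoc trace_inner_cyclic)
  also have "\<dots> = (\<Sum>j<n. w j * trace_inner (?W * P) (X j))"
    using P X by (intro trace_inner_mat_lincomb) (auto intro: mult_carrier_mat[of _ d d])
  also have "\<dots> = (\<Sum>j<n. w j * trace_inner (P * X j) ?W)"
  proof (intro sum.cong refl)
    fix j assume "j \<in> {..<n}"
    then have "X j \<in> carrier_mat d d" using X by simp
    then show "w j * trace_inner (?W * P) (X j) = w j * trace_inner (P * X j) ?W"
      using P by (metis mat_lincomb_carrier trace_inner_assoc trace_inner_cyclic)
  qed
  also have "\<dots> = (\<Sum>j<n. \<Sum>i<n. w i * w j * trace_inner (P * X j) (X i))"
  proof (intro sum.cong refl)
    fix j assume "j \<in> {..<n}"
    then have "trace_inner (P * X j) ?W = (\<Sum>i<n. w i * trace_inner (P * X j) (X i))"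
      using P X by (intro trace_inner_mat_lincomb) (auto intro: mult_carrier_mat[of _ d d])
    then show "w j * trace_inner (P * X j) ?W = (\<Sum>i<n. w i * w j * trace_inner (P * X j) (X i))"
      by (simp add: sum_distrib_left mult_ac)
  qed
  also have "\<dots> = (\<Sum>j<n. \<Sum>i<n. w j * w i * trace_inner P (X j * X i))"
    using P X by (intro sum.cong refl) (simp add: trace_inner_assoc mult_ac)
  finally show ?thesis .
qed

text \<open>The quadratic form of a Gram matrix is a squared norm, so a zero of the form yields a
  linear relation among the \<open>X i\<close>.\<close>

lemma gram_form:
  assumes X: "\<And>i. i < n \<Longrightarrow> X i \<in> carrier_mat d d" and A: "A \<in> carrier_mat n n"
    and gram: "\<And>i j. i < n \<Longrightarrow> j < n \<Longrightarrow> A $$ (i, j) = trace_inner (X i) (X j)"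
    and w: "w \<in> carrier_vec n"
  shows "w \<bullet> (A *\<^sub>v w)
    = trace_inner (mat_lincomb d n (vec_index w) X) (mat_lincomb d n (vec_index w) X)"
proof -
  let ?W = "mat_lincomb d n (vec_index w) X"
  have 1: "trace_inner (1\<^sub>m d) (Y * Z) = trace_inner Y Z"
    if "Y \<in> carrier_mat d d" "Z \<in> carrier_mat d d" for Y Z
    using trace_inner_assoc[of "1\<^sub>m d" d Y Z] that by simp
  have "trace_inner (1\<^sub>m d) (?W * ?W) = (\<Sum>i<n. \<Sum>j<n. w $ i * w $ j * trace_inner (1\<^sub>m d) (X i * X j))"
    using X by (intro trace_inner_mat_lincomb_square) auto
  also have "\<dots> = (\<Sum>i<n. \<Sum>j<n. w $ i * w $ j * A $$ (i, j))"
    using X by (intro sum.cong refl) (simp add: 1 gram)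
  finally show ?thesis using form_eq_sum[OF A w] by (simp add: 1)
qed

section \<open>Cycles and matrices of corank at least 2\<close>

text \<open>Replacing row \<open>k\<close> by the \<open>k\<close>-th unit vector raises the rank by
  at most 1, so the new matrix is still singular. A kernel vector \<open>w\<close> has
  \<open>w $ k = 0\<close>, and \<open>A *\<^sub>v w\<close> vanishes away from \<open>k\<close>;
  hence every summand of the form is 0.\<close>

lemma null_form_vec_of_rank:
  fixes A :: "real mat"
  assumes A: "A \<in> carrier_mat n n" and rank: "vec_space.rank n A + 2 \<le> n" and k: "k < n"
  obtains w where "w \<in> carrier_vec n" "w \<noteq> 0\<^sub>v n" "w $ k = 0" "w \<bullet> (A *\<^sub>v w) = 0"
proof -
  interpret vec_space "TYPE(real)" n .
  \<comment> \<open>\<open>A + B\<close> is \<open>A\<close> with row \<open>k\<close> replaced by the \<open>k\<close>-th unit vector.\<close>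
  define B :: "real mat" where
    "B = mat n n (\<lambda>(r, c). of_bool (r = k) * (of_bool (c = k) - A $$ (k, c)))"
  have B: "B \<in> carrier_mat n n" by (simp add: B_def)
  have "rank B \<le> 1" by (rule rank_le_1_product_entries[OF B]) (simp add: B_def)
  then have "rank (A + B) \<noteq> n" using rank_subadditive[OF A B] rank by simp
  then have "det (A + B) = 0" using det_rank_iff[of "A + B"] A B by auto
  then obtain w where w: "w \<in> carrier_vec n" "w \<noteq> 0\<^sub>v n" "(A + B) *\<^sub>v w = 0\<^sub>v n"
    using det_0_iff_vec_prod_zero[of "A + B" n] A B by auto
  have entry: "(A *\<^sub>v w) $ i + (B *\<^sub>v w) $ i = 0" if "i < n" for i
    using arg_cong[OF w(3), of "\<lambda>v. v $ i"] that A B w(1)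
    by (simp add: add_mult_distrib_mat_vec[of _ n n])
  have Bi: "(B *\<^sub>v w) $ i = (if i = k then w $ k - (A *\<^sub>v w) $ k else 0)" if "i < n" for i
  proof (cases "i = k")
    case True
    have "row B k = unit_vec n k - row A k"
      using A k by (auto simp: B_def unit_vec_def intro!: eq_vecI)
    then show ?thesis using True A B k w(1) by (simp add: minus_scalar_prod_distrib[of _ n])
  next
    case False
    then have "row B i = 0\<^sub>v n" using that by (auto simp: B_def intro!: eq_vecI)
    then show ?thesis using False B that w(1) by simp
  qed
  have "w $ k = 0" using entry[OF k] Bi[OF k] by simp
  moreover have "w $ i * (A *\<^sub>v w) $ i = 0" if "i < n" for i
    using entry[OF that] Bi[OF that] \<open>w $ k = 0\<close> by (cases "i = k") auto
  then have "w \<bullet> (A *\<^sub>v w) = 0"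
    using A unfolding scalar_prod_def[of w] by (intro sum.neutral) auto
  ultimately show ?thesis using w that by blast
qed

text \<open>A cycle of length at least 4 has no triangle: a third position next to both
  \<open>s\<close> and \<open>Suc s\<close> would be \<open>s - 1\<close> and \<open>s + 2\<close>
  modulo \<open>n\<close> at once, forcing \<open>n\<close> to divide 3.\<close>

lemma cycle_edge_no_common_neighbour:
  assumes n: "4 \<le> n" and v: "inj_on v {..<n}" and s: "Suc s < n" and t: "t < n" "t \<noteq> s" "t \<noteq> Suc s"
  defines "E \<equiv> {{v i, v (Suc i mod n)} | i. i < n}"
  shows "{v s, v t} \<notin> E \<or> {v t, v (Suc s)} \<notin> E"
proof -
  have edge: "b = Suc a mod n \<or> a = Suc b mod n" if ab: "{v a, v b} \<in> E" "a < n" "b < n" for a b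
  proof -
    obtain i where i: "i < n" "{v a, v b} = {v i, v (Suc i mod n)}" using ab(1) unfolding E_def by blast
    then have "v a = v i \<and> v b = v (Suc i mod n) \<or> v b = v i \<and> v a = v (Suc i mod n)"
      by (auto simp: doubleton_eq_iff)
    moreover have "Suc i mod n < n" using n by simp
    ultimately show ?thesis using inj_onD[OF v] i(1) ab(2,3) by (metis lessThan_iff)
  qed
  show ?thesis
  proof (rule ccontr)
    assume "\<not> ?thesis"
    then have "t = Suc s mod n \<or> s = Suc t mod n" "Suc s = Suc t mod n \<or> t = Suc (Suc s) mod n"
      using edge[of s t] edge[of t "Suc s"] s t by auto
    then show False using n s t by (auto simp: mod_Suc split: if_splits)
  qed
qed


lemma cycle_rank_not_cpsd:
  assumes n: "4 \<le> n" and A: "A \<in> sym_mats n" and cyc: "is_cycle_graph n (support_edges A)"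
    and rank: "vec_space.rank n A + 2 \<le> n"
  shows "A \<notin> cpsd_mats n"
proof
  assume "A \<in> cpsd_mats n"
  then obtain d X where X: "\<And>i. i < n \<Longrightarrow> X i \<in> psd_mats d"
    and gram: "\<And>i j. i < n \<Longrightarrow> j < n \<Longrightarrow> A $$ (i, j) = trace_inner (X i) (X j)"
    unfolding cpsd_mats_def by blast
  note XC = sym_matsD[OF psd_mats_sym[OF X]]
  obtain v where v: "bij_betw v {..<n} {..<n}"
    and E: "support_edges A = {{v i, v (Suc i mod n)} | i. i < n}"
    using cyc unfolding is_cycle_graph_def by blast
  have vn: "v i < n" if "i < n" for i using v that by (auto simp: bij_betw_def)
  have inj: "inj_on v {..<n}" using v by (simp add: bij_betw_def)
  have edgeI: "{i, j} \<in> support_edges A" if "i < n" "j < n" "i \<noteq> j" "A $$ (i, j) \<noteq> 0" for i j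
    using that sym_matsD(3,4)[OF A] unfolding support_edges_def by blast
  obtain w where w: "w \<in> carrier_vec n" "w \<noteq> 0\<^sub>v n" "w $ v 0 = 0" "w \<bullet> (A *\<^sub>v w) = 0"
    using null_form_vec_of_rank[OF sym_matsD(1)[OF A] rank vn[of 0]] n by auto
  define W where "W = mat_lincomb d n (vec_index w) X"
  have "trace_inner W W = 0"
    using gram_form[OF XC(1) sym_matsD(1)[OF A] gram w(1)] w(4) by (simp add: W_def)
  then have W0: "W = 0\<^sub>m d d"
    unfolding W_def using X psd_mats_sym by (intro trace_inner_self_eq_0D mat_lincomb_sym) auto
  obtain i where "i < n" "w $ i \<noteq> 0" using w(1,2) by (auto simp: vec_eq_iff)
  then have "\<exists>t<n. w $ v t \<noteq> 0"
    using v by (metis bij_betw_imp_surj_on image_iff lessThan_iff)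
  \<comment> \<open>The first position along the cycle where \<open>w\<close> is nonzero. It is not
    0, as \<open>w\<close> vanishes at \<open>v 0\<close>; so the edge from its predecessor
    \<open>s\<close> joins a zero of \<open>w\<close> to a nonzero.\<close>
  then obtain t where t: "t < n" "w $ v t \<noteq> 0" "\<And>r. r < t \<Longrightarrow> r < n \<Longrightarrow> w $ v r = 0"
    using exists_least_iff[of "\<lambda>t. t < n \<and> w $ v t \<noteq> 0"] by blast
  then obtain s where s: "t = Suc s" using w(3) by (cases t) auto
  define j where "j = v s"
  define k where "k = v (Suc s)"
  have jk: "j < n" "k < n" using t(1) s vn by (simp_all add: j_def k_def)
  have "j \<noteq> k" using inj_onD[OF inj, of s "Suc s"] t(1) s by (auto simp: j_def k_def)
  have wj: "w $ j = 0" and wk: "w $ k \<noteq> 0" using t(1,2) t(3)[of s] s by (simp_all add: j_def k_def)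
  note Xj = XC(1)[OF jk(1)] and Xk = XC(1)[OF jk(2)]
  \<comment> \<open>Cyclically, \<open>X i\<close> stands between \<open>X j\<close> and
    \<open>X k\<close> in the product \<open>Q * X i\<close>. So the trace vanishes if
    \<open>i\<close> is not adjacent to one of \<open>j\<close>, \<open>k\<close>, while for
    \<open>i = k\<close> it is the squared norm of \<open>X k * X j\<close>.\<close>
  define Q where "Q = X k * (X j * X j)"
  have Q: "Q \<in> carrier_mat d d" using Xj Xk by (simp add: Q_def)
  have zero: "w $ i * trace_inner Q (X i) = 0" if i: "i < n" "i \<noteq> k" for i
  proof (cases "i = j")
    case True
    then show ?thesis using wj by simp
  next
    case False
    note Xi = XC(1)[OF that(1)]
    obtain r where r: "i = v r" "r < n"
      using v i(1) by (metis bij_betw_imp_surj_on image_iff lessThan_iff)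
    have "{j, i} \<notin> support_edges A \<or> {i, k} \<notin> support_edges A"
      using cycle_edge_no_common_neighbour[OF n inj, of s r] r s t(1) False that(2)
      unfolding E j_def k_def by blast
    then have "A $$ (j, i) = 0 \<or> A $$ (i, k) = 0" using edgeI[of j i] edgeI[of i k] that jk False by blast
    then have "X j * X i = 0\<^sub>m d d \<or> X i * X k = 0\<^sub>m d d"
      using trace_inner_psd_eq_0D[OF X X] gram jk that(1) by metis
    moreover have "trace_inner Q (X i) = trace_inner (X k * X j) (X j * X i)"
      using Xi Xj Xk by (simp add: Q_def trace_inner_def assoc_mult_mat[of _ d d _ d _ d])
    moreover have "trace_inner Q (X i) = trace_inner (X j * X j) (X i * X k)"
      using Xi Xj Xk unfolding Q_def by (simp add: trace_inner_assoc trace_inner_cyclic[of "X k"])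
    ultimately have "trace_inner Q (X i) = 0"
      using Xi Xj Xk by (auto simp: trace_inner_zero[of _ d])
    then show ?thesis by simp
  qed
  have "0 = trace_inner Q W" using Q by (simp add: W0 trace_inner_zero)
  also have "\<dots> = (\<Sum>i<n. w $ i * trace_inner Q (X i))"
    unfolding W_def by (rule trace_inner_mat_lincomb[OF Q XC(1)])
  also have "\<dots> = (\<Sum>i\<in>{k}. w $ i * trace_inner Q (X i))"
    using zero jk by (intro sum.mono_neutral_right) auto
  finally have "trace_inner Q (X k) = 0" using wk by simp
  moreover have "transpose_mat (X k * X j) = X j * X k"
    using Xj Xk XC(2) jk by (simp add: transpose_mult[of _ d d])
  moreover have "trace_inner Q (X k) = trace_inner (X k * X j) (X j * X k)"
    using Xj Xk by (simp add: Q_def trace_inner_def assoc_mult_mat[of _ d d _ d _ d])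
  ultimately have "X k * X j = 0\<^sub>m d d"
    using Xj Xk by (intro trace_inner_transpose_eq_0D) auto
  then have "A $$ (k, j) = 0"
    using gram jk Xk Xj by (simp add: trace_inner_def mat_trace_def)
  then have A0: "A $$ (k, j) = 0" "A $$ (j, k) = 0" using sym_mats_entry[OF A] jk by auto
  have "{j, k} \<in> support_edges A"
    unfolding E j_def k_def using t(1) s by (auto intro!: exI[of _ s])
  then show False unfolding support_edges_def using A0 by (auto simp: doubleton_eq_iff)
qed

section \<open>Extreme rays of the doubly nonnegative cone\<close>

text \<open>Positive semidefiniteness and nonnegativity of entries both reduce to the scalar
  inequality \<open>key\<close>, with \<open>a\<close> a value of the form or an entry of
  \<open>A\<close>.\<close>

lemma dnn_mats_add_smult:
  assumes A: "A \<in> dnn_mats n" and M: "M \<in> sym_mats n" and e: "\<bar>e\<bar> * c \<le> 1" "0 \<le> c"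
    and form: "\<And>w. w \<in> carrier_vec n \<Longrightarrow> \<bar>w \<bullet> (M *\<^sub>v w)\<bar> \<le> c * (w \<bullet> (A *\<^sub>v w))"
    and entry: "\<And>i j. i < n \<Longrightarrow> j < n \<Longrightarrow> \<bar>M $$ (i, j)\<bar> \<le> c * A $$ (i, j)"
  shows "A + e \<cdot>\<^sub>m M \<in> dnn_mats n"
proof -
  have psd: "A \<in> psd_mats n" using A by (simp add: dnn_mats_def)
  note AC = sym_matsD[OF psd_mats_sym[OF psd]]
  note MC = sym_matsD[OF M]
  have key: "0 \<le> a + e * m" if "\<bar>m\<bar> \<le> c * a" "0 \<le> a" for a m :: real
  proof -
    have "\<bar>e * m\<bar> \<le> \<bar>e\<bar> * (c * a)" using that(1) by (simp add: abs_mult mult_left_mono)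
    also have "\<dots> \<le> a" using mult_right_mono[OF e(1) that(2)] by (simp add: mult_ac)
    finally show ?thesis by linarith
  qed
  have "A + e \<cdot>\<^sub>m M \<in> sym_mats n"
    using AC MC sym_mats_entry[OF psd_mats_sym[OF psd]] sym_mats_entry[OF M]
    by (intro sym_matsI) auto
  moreover have "0 \<le> w \<bullet> ((A + e \<cdot>\<^sub>m M) *\<^sub>v w)" if w: "w \<in> carrier_vec n" for w
  proof -
    have C: "A + e \<cdot>\<^sub>m M \<in> carrier_mat n n" using AC MC by simp
    have "w \<bullet> ((A + e \<cdot>\<^sub>m M) *\<^sub>v w) = w \<bullet> (A *\<^sub>v w) + e * (w \<bullet> (M *\<^sub>v w))"
      unfolding form_eq_sum[OF C w] form_eq_sum[OF AC(1) w] form_eq_sum[OF MC(1) w]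
      using AC MC by (simp add: sum.distrib sum_distrib_left algebra_simps)
    then show ?thesis using key form[OF w] psd_mats_form_nonneg[OF psd w] by simp
  qed
  moreover have "0 \<le> (A + e \<cdot>\<^sub>m M) $$ (i, j)" if "i < n" "j < n" for i j
    using that A AC MC key[OF entry[OF that]] by (simp add: dnn_mats_def)
  ultimately show ?thesis by (simp add: dnn_mats_def psd_mats_def)
qed

lemma psd_mats_smult:
  assumes B: "B \<in> psd_mats n" and s: "0 \<le> s"
  shows "s \<cdot>\<^sub>m B \<in> psd_mats n"
proof -
  note BC = sym_matsD[OF psd_mats_sym[OF B]]
  have C: "s \<cdot>\<^sub>m B \<in> carrier_mat n n" using BC by simp
  have "s \<cdot>\<^sub>m B \<in> sym_mats n"
    using BC sym_mats_entry[OF psd_mats_sym[OF B]] by (intro sym_matsI) auto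
  moreover have "0 \<le> w \<bullet> ((s \<cdot>\<^sub>m B) *\<^sub>v w)" if w: "w \<in> carrier_vec n" for w
  proof -
    have "w \<bullet> ((s \<cdot>\<^sub>m B) *\<^sub>v w) = s * (w \<bullet> (B *\<^sub>v w))"
      unfolding form_eq_sum[OF C w] form_eq_sum[OF BC(1) w]
      using BC by (simp add: sum_distrib_left mult_ac)
    then show ?thesis using psd_mats_form_nonneg[OF B w] s by simp
  qed
  ultimately show ?thesis by (simp add: psd_mats_def)
qed

lemma dnn_mats_smult:
  assumes "B \<in> dnn_mats n" "0 \<le> s"
  shows "s \<cdot>\<^sub>m B \<in> dnn_mats n"
proof -
  have psd: "B \<in> psd_mats n" and nonneg: "\<And>i j. i < n \<Longrightarrow> j < n \<Longrightarrow> 0 \<le> B $$ (i, j)"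
    using assms(1) by (auto simp: dnn_mats_def)
  then show ?thesis
    using psd_mats_smult[OF psd assms(2)] nonneg assms(2) sym_matsD[OF psd_mats_sym[OF psd]]
    by (simp add: dnn_mats_def)
qed

text \<open>For small \<open>e\<close> both \<open>A + e M\<close> and \<open>A - e M\<close> lie in
  the cone, and their sum \<open>2 A\<close> lies on the ray. Extremality puts
  \<open>A + e M\<close> on the ray as well.\<close>

lemma extreme_ray_dnn_dominated:
  assumes ext: "extreme_ray (dnn_mats n) R" and A: "A \<in> R" "A \<noteq> 0\<^sub>m n n"
    and M: "M \<in> sym_mats n"
    and form: "\<And>w. w \<in> carrier_vec n \<Longrightarrow> \<bar>w \<bullet> (M *\<^sub>v w)\<bar> \<le> c * (w \<bullet> (A *\<^sub>v w))"
    and entry: "\<And>i j. i < n \<Longrightarrow> j < n \<Longrightarrow> \<bar>M $$ (i, j)\<bar> \<le> c * A $$ (i, j)"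
  obtains t where "M = t \<cdot>\<^sub>m A"
proof -
  obtain B where B: "B \<in> dnn_mats n" and R: "R = {t \<cdot>\<^sub>m B | t. 0 \<le> t}"
    using ext unfolding extreme_ray_def by blast
  obtain s where s: "A = s \<cdot>\<^sub>m B" "0 \<le> s" using A(1) R by blast
  have BC: "B \<in> carrier_mat n n" using B by (simp add: dnn_mats_def psd_mats_def sym_mats_def)
  have "s \<noteq> 0" using s A(2) BC by auto
  then have s0: "s > 0" using s by simp
  have AC: "A \<in> carrier_mat n n" using s BC by simp
  have Apsd: "A \<in> dnn_mats n"
    using dnn_mats_smult[OF B s(2)] s(1) by simp
  \<comment> \<open>A positive bound that dominates \<open>c\<close> whatever its sign, so that
    \<open>1 / b\<close> is an admissible step size.\<close>
  define b where "b = \<bar>c\<bar> + 1"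
  have b: "b > 0" "c \<le> b" by (auto simp: b_def)
  have formb: "\<bar>w \<bullet> (M *\<^sub>v w)\<bar> \<le> b * (w \<bullet> (A *\<^sub>v w))" if "w \<in> carrier_vec n" for w
  proof -
    have "0 \<le> w \<bullet> (A *\<^sub>v w)" using Apsd that by (simp add: dnn_mats_def psd_mats_def)
    then show ?thesis using form[OF that] mult_right_mono[OF b(2)] by force
  qed
  have entryb: "\<bar>M $$ (i, j)\<bar> \<le> b * A $$ (i, j)" if "i < n" "j < n" for i j
  proof -
    have "0 \<le> A $$ (i, j)" using Apsd that by (simp add: dnn_mats_def)
    then show ?thesis using entry[OF that] mult_right_mono[OF b(2)] by force
  qed
  have "A + (1 / b) \<cdot>\<^sub>m M \<in> dnn_mats n" "A + (- 1 / b) \<cdot>\<^sub>m M \<in> dnn_mats n"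
    using b by (auto intro!: dnn_mats_add_smult[OF Apsd M _ _ formb entryb])
  moreover have "A + (1 / b) \<cdot>\<^sub>m M + (A + (- 1 / b) \<cdot>\<^sub>m M) = (2 * s) \<cdot>\<^sub>m B"
    using s BC sym_matsD[OF M] by (auto intro!: eq_matI)
  then have "A + (1 / b) \<cdot>\<^sub>m M + (A + (- 1 / b) \<cdot>\<^sub>m M) \<in> R"
    unfolding R using s(2) by (auto intro!: exI[of _ "2 * s"])
  ultimately have "A + (1 / b) \<cdot>\<^sub>m M \<in> R" using ext unfolding extreme_ray_def by blast
  then obtain t where t: "A + (1 / b) \<cdot>\<^sub>m M = t \<cdot>\<^sub>m B" using R by blast
  \<comment> \<open>The factor comes from solving \<open>A + M / b = t B\<close> with
    \<open>B = A / s\<close>.\<close>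
  have "M = (b * (t / s - 1)) \<cdot>\<^sub>m A"
  proof (rule eq_matI)
    fix i j assume "i < dim_row ((b * (t / s - 1)) \<cdot>\<^sub>m A)" "j < dim_col ((b * (t / s - 1)) \<cdot>\<^sub>m A)"
    then have ij: "i < n" "j < n" using AC by auto
    have tB: "A $$ (i, j) + M $$ (i, j) / b = t * B $$ (i, j)"
      using arg_cong[OF t, of "\<lambda>Z. Z $$ (i, j)"] ij AC BC sym_matsD[OF M] by simp
    have sB: "A $$ (i, j) = s * B $$ (i, j)" using s(1) ij BC by simp
    have "M $$ (i, j) = b * (t * B $$ (i, j) - A $$ (i, j))"
      using b(1) by (simp flip: tB)
    also have "\<dots> = b * (t / s - 1) * A $$ (i, j)"
      using s0 by (simp add: sB algebra_simps)
    finally show "M $$ (i, j) = ((b * (t / s - 1)) \<cdot>\<^sub>m A) $$ (i, j)"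
      using ij AC by simp
  qed (use AC sym_matsD[OF M] in auto)
  then show thesis by (rule that)
qed

text \<open>Nonnegative vectors become diagonal positive semidefinite matrices, whose trace inner
  product is the scalar product of the diagonals.\<close>

lemma cp_mats_subset_cpsd_mats: "cp_mats n \<subseteq> cpsd_mats n"
proof
  fix A assume "A \<in> cp_mats n"
  then obtain d x where A: "A \<in> sym_mats n" and d: "1 \<le> d"
    and x: "\<And>i. i < n \<Longrightarrow> x i \<in> carrier_vec d" "\<And>i k. i < n \<Longrightarrow> k < d \<Longrightarrow> 0 \<le> x i $ k"
    and gram: "\<And>i j. i < n \<Longrightarrow> j < n \<Longrightarrow> A $$ (i, j) = x i \<bullet> x j"
    unfolding cp_mats_def by blast
  define X where "X i = mat d d (\<lambda>(a, b). if a = b then x i $ a else 0)" for i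
  have "X i \<in> psd_mats d" if i: "i < n" for i
  proof -
    have "0 \<le> v \<bullet> (X i *\<^sub>v v)" if v: "v \<in> carrier_vec d" for v
    proof -
      have "v \<bullet> (X i *\<^sub>v v) = (\<Sum>a<d. \<Sum>b<d. v $ a * v $ b * X i $$ (a, b))"
        by (rule form_eq_sum[OF _ v]) (simp add: X_def)
      also have "\<dots> \<ge> 0" using x(2)[OF i] by (auto simp: X_def intro!: sum_nonneg)
      finally show ?thesis .
    qed
    moreover have "X i \<in> sym_mats d" by (rule sym_matsI) (auto simp: X_def)
    ultimately show ?thesis by (simp add: psd_mats_def)
  qed
  moreover have "A $$ (i, j) = trace_inner (X i) (X j)" if "i < n" "j < n" for i j
  proof -
    have "trace_inner (X i) (X j) = (\<Sum>a<d. \<Sum>b<d. if b = a then x i $ a * x j $ a else 0)"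
      by (subst trace_inner_eq_sum[of _ d d]) (auto simp: X_def simp del: sum.delta sum.delta' intro!: sum.cong)
    then show ?thesis using that carrier_vecD[OF x(1)[OF that(2)]]
      by (simp add: gram scalar_prod_def lessThan_atLeast0)
  qed
  ultimately show "A \<in> cpsd_mats n" using A d unfolding cpsd_mats_def by blast
qed


text \<open>An entry of \<open>W * W\<close> is a scalar product of two rows of \<open>W\<close>,
  hence at most the mean of their squared norms, and each of these is at most the squared norm of
  \<open>W\<close>. The constant depends on \<open>P\<close> alone.\<close>

lemma abs_trace_inner_square_le:
  assumes P: "P \<in> carrier_mat d d" and W: "W \<in> sym_mats d"
  shows "\<bar>trace_inner P (W * W)\<bar> \<le> (\<Sum>a<d. \<Sum>b<d. \<bar>P $$ (a, b)\<bar>) * trace_inner W W"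
proof -
  note WC = sym_matsD[OF W]
  have T: "trace_inner W W = (\<Sum>a<d. \<Sum>b<d. (W $$ (a, b))\<^sup>2)"
    using trace_inner_transpose[OF WC(1)] WC(2) by simp
  have row: "(\<Sum>k<d. (W $$ (a, k))\<^sup>2) \<le> trace_inner W W" if "a < d" for a
    unfolding T using that by (intro member_le_sum[of a "{..<d}"]) (auto intro: sum_nonneg)
  have entry: "\<bar>(W * W) $$ (b, a)\<bar> \<le> trace_inner W W" if ab: "a < d" "b < d" for a b
  proof -
    have "\<bar>(W * W) $$ (b, a)\<bar> = \<bar>\<Sum>k<d. W $$ (b, k) * W $$ (a, k)\<bar>"
      using WC ab sym_mats_entry[OF W] by (simp add: scalar_prod_def lessThan_atLeast0)
    also have "\<dots> \<le> (\<Sum>k<d. \<bar>W $$ (b, k) * W $$ (a, k)\<bar>)" by (rule sum_abs)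
    also have "\<dots> \<le> (\<Sum>k<d. ((W $$ (b, k))\<^sup>2 + (W $$ (a, k))\<^sup>2) / 2)"
    proof (rule sum_mono)
      fix k
      show "\<bar>W $$ (b, k) * W $$ (a, k)\<bar> \<le> ((W $$ (b, k))\<^sup>2 + (W $$ (a, k))\<^sup>2) / 2"
        using sum_squares_bound[of "\<bar>W $$ (b, k)\<bar>" "\<bar>W $$ (a, k)\<bar>"] by (simp add: abs_mult)
    qed
    also have "\<dots> = ((\<Sum>k<d. (W $$ (b, k))\<^sup>2) + (\<Sum>k<d. (W $$ (a, k))\<^sup>2)) / 2"
      by (simp add: sum.distrib flip: sum_divide_distrib)
    also have "\<dots> \<le> trace_inner W W" using row[OF ab(1)] row[OF ab(2)] by simp
    finally show ?thesis .
  qed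
  have "\<bar>trace_inner P (W * W)\<bar> = \<bar>\<Sum>a<d. \<Sum>b<d. P $$ (a, b) * (W * W) $$ (b, a)\<bar>"
    using P WC by (subst trace_inner_eq_sum[of _ d d]) auto
  also have "\<dots> \<le> (\<Sum>a<d. \<bar>\<Sum>b<d. P $$ (a, b) * (W * W) $$ (b, a)\<bar>)" by (rule sum_abs)
  also have "\<dots> \<le> (\<Sum>a<d. \<Sum>b<d. \<bar>P $$ (a, b) * (W * W) $$ (b, a)\<bar>)"
    by (intro sum_mono sum_abs)
  also have "\<dots> \<le> (\<Sum>a<d. \<Sum>b<d. \<bar>P $$ (a, b)\<bar> * trace_inner W W)"
    unfolding abs_mult using entry by (intro sum_mono mult_left_mono) auto
  also have "\<dots> = (\<Sum>a<d. \<Sum>b<d. \<bar>P $$ (a, b)\<bar>) * trace_inner W W"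
    by (simp add: sum_distrib_right)
  finally show ?thesis .
qed

text \<open>The left-hand sides form a matrix \<open>M\<close>, symmetrised because
  \<open>trace_inner P (X i * X j)\<close> need not be symmetric in \<open>i\<close> and
  \<open>j\<close>. It is dominated by \<open>A\<close> as \<open>extreme_ray_dnn_dominated\<close>
  demands.\<close>

lemma extreme_ray_dnn_gram_products:
  assumes ext: "extreme_ray (dnn_mats n) R" and A: "A \<in> R" "A \<noteq> 0\<^sub>m n n" "A \<in> carrier_mat n n"
    and X: "\<And>i. i < n \<Longrightarrow> X i \<in> psd_mats d"
    and gram: "\<And>i j. i < n \<Longrightarrow> j < n \<Longrightarrow> A $$ (i, j) = trace_inner (X i) (X j)"
    and P: "P \<in> carrier_mat d d"
  obtains t where "\<And>i j. i < n \<Longrightarrow> j < n \<Longrightarrow>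
    trace_inner P (X i * X j) + trace_inner P (X j * X i) = t * A $$ (i, j)"
proof -
  note XC = sym_matsD[OF psd_mats_sym[OF X]]
  define M where "M = mat n n (\<lambda>(i, j). trace_inner P (X i * X j) + trace_inner P (X j * X i))"
  have MC: "M \<in> carrier_mat n n" by (simp add: M_def)
  \<comment> \<open>\<open>2 * K\<close> controls the form of \<open>M\<close> and \<open>L\<close>
    its entries. Both are nonnegative, so \<open>2 * K + L\<close> serves for both bounds.\<close>
  define K where "K = (\<Sum>a<d. \<Sum>b<d. \<bar>P $$ (a, b)\<bar>)"
  \<comment> \<open>The summands with \<open>A $$ (i, j) = 0\<close> are 0.\<close>
  define L where "L = (\<Sum>i<n. \<Sum>j<n. \<bar>M $$ (i, j)\<bar> / A $$ (i, j))"
  have Anonneg: "0 \<le> A $$ (i, j)" if "i < n" "j < n" for i j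
    using that gram trace_inner_psd[OF X X] by simp
  have K: "0 \<le> K" unfolding K_def by (intro sum_nonneg) auto
  have L: "0 \<le> L" unfolding L_def by (intro sum_nonneg) (auto simp: Anonneg)
  have "M \<in> sym_mats n" by (rule sym_matsI[OF MC]) (simp add: M_def)
  moreover have "\<bar>w \<bullet> (M *\<^sub>v w)\<bar> \<le> (2 * K + L) * (w \<bullet> (A *\<^sub>v w))" if w: "w \<in> carrier_vec n" for w
  proof -
    define W where "W = mat_lincomb d n (vec_index w) X"
    have W: "W \<in> sym_mats d" unfolding W_def using X psd_mats_sym by (intro mat_lincomb_sym) auto
    have A_form: "w \<bullet> (A *\<^sub>v w) = trace_inner W W"
      unfolding W_def by (rule gram_form[OF XC(1) A(3) gram w])
    have "w \<bullet> (M *\<^sub>v w) = (\<Sum>i<n. \<Sum>j<n. w $ i * w $ j * trace_inner P (X i * X j))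
        + (\<Sum>i<n. \<Sum>j<n. w $ i * w $ j * trace_inner P (X j * X i))"
      unfolding form_eq_sum[OF MC w] by (simp add: M_def sum.distrib algebra_simps)
    also have "(\<Sum>i<n. \<Sum>j<n. w $ i * w $ j * trace_inner P (X j * X i))
        = (\<Sum>i<n. \<Sum>j<n. w $ i * w $ j * trace_inner P (X i * X j))"
      by (subst sum.swap) (simp add: mult_ac)
    also have "(\<Sum>i<n. \<Sum>j<n. w $ i * w $ j * trace_inner P (X i * X j)) = trace_inner P (W * W)"
      unfolding W_def by (rule trace_inner_mat_lincomb_square[OF P XC(1), symmetric])
    finally have "\<bar>w \<bullet> (M *\<^sub>v w)\<bar> \<le> 2 * (K * trace_inner W W)"
      using abs_trace_inner_square_le[OF P W] by (simp add: K_def)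
    also have "\<dots> \<le> (2 * K + L) * trace_inner W W"
      using L trace_inner_transpose[of W d] sym_matsD[OF W] by (simp add: algebra_simps sum_nonneg)
    finally show ?thesis by (simp add: A_form)
  qed
  moreover have "\<bar>M $$ (i, j)\<bar> \<le> (2 * K + L) * A $$ (i, j)" if ij: "i < n" "j < n" for i j
  proof (cases "A $$ (i, j) = 0")
    case True
    then have "X i * X j = 0\<^sub>m d d" "X j * X i = 0\<^sub>m d d"
      using trace_inner_psd_eq_0D[OF X X] gram[OF ij] ij
        trace_inner_commute[OF XC(1) XC(1), OF ij] by auto
    then show ?thesis using True ij P by (simp add: M_def trace_inner_zero)
  next
    case False
    then have pos: "A $$ (i, j) > 0" using Anonneg[OF ij] by simp
    have "\<bar>M $$ (i, j)\<bar> / A $$ (i, j) \<le> (\<Sum>j<n. \<bar>M $$ (i, j)\<bar> / A $$ (i, j))"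
      using ij by (intro member_le_sum[of j "{..<n}" "\<lambda>j. \<bar>M $$ (i, j)\<bar> / A $$ (i, j)"]) (auto simp: Anonneg)
    also have "\<dots> \<le> L"
      unfolding L_def using ij
      by (intro member_le_sum[of i "{..<n}" "\<lambda>i. \<Sum>j<n. \<bar>M $$ (i, j)\<bar> / A $$ (i, j)"])
        (auto intro!: sum_nonneg simp: Anonneg)
    finally have "\<bar>M $$ (i, j)\<bar> \<le> L * A $$ (i, j)" using pos by (simp add: field_simps)
    also have "\<dots> \<le> (2 * K + L) * A $$ (i, j)" using K pos by (intro mult_right_mono) auto
    finally show ?thesis .
  qed
  ultimately obtain t where t: "M = t \<cdot>\<^sub>m A" using extreme_ray_dnn_dominated[OF ext A(1,2)] by blast
  show thesis
  proof (rule that[of t])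
    fix i j assume "i < n" "j < n"
    then show "trace_inner P (X i * X j) + trace_inner P (X j * X i) = t * A $$ (i, j)"
      using arg_cong[OF t, of "\<lambda>Z. Z $$ (i, j)"] A(3) by (simp add: M_def)
  qed
qed

text \<open>With \<open>D = Y - Z\<close>, the hypothesis amounts to \<open>Tr (D\<^sup>2 (Y + Z)) = 0\<close>.\<close>

lemma psd_eq_of_trace_squares:
  assumes Y: "Y \<in> psd_mats d" and Z: "Z \<in> psd_mats d"
    and eq: "trace_inner (Y - Z) (Y * Y) = trace_inner (Y - Z) (Z * Z)"
  shows "Y = Z"
proof -
  note YC = sym_matsD[OF psd_mats_sym[OF Y]] and ZC = sym_matsD[OF psd_mats_sym[OF Z]]
  define D where "D = Y - Z"
  have DC: "D \<in> carrier_mat d d" using YC ZC by (simp add: D_def minus_carrier_mat)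
  have D: "D \<in> sym_mats d"
    unfolding D_def using YC ZC sym_mats_entry[OF psd_mats_sym[OF Y]] sym_mats_entry[OF psd_mats_sym[OF Z]]
    by (intro sym_matsI) auto
  note DT = sym_matsD(2)[OF D]
  have DD: "D * D \<in> psd_mats d"
  proof -
    have "D * D \<in> sym_mats d" using DC DT by (simp add: sym_mats_def transpose_mult[of _ d d])
    moreover have "0 \<le> v \<bullet> ((D * D) *\<^sub>v v)" if v: "v \<in> carrier_vec d" for v
    proof -
      have "v \<bullet> ((D * D) *\<^sub>v v) = (D *\<^sub>v v) \<bullet> (D *\<^sub>v v)"
        using transpose_vec_mult_scalar[OF DC _ v, of "D *\<^sub>v v"] DC DT v by simp
      then show ?thesis by (simp add: self_scalar_prod(1))
    qed
    ultimately show ?thesis by (simp add: psd_mats_def)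
  qed
  have YY: "trace_inner D (D * Y) = trace_inner D (Y * Y) - trace_inner D (Z * Y)"
    "trace_inner D (D * Z) = trace_inner D (Y * Z) - trace_inner D (Z * Z)"
  proof -
    have sub: "trace_inner D (U - V) = trace_inner D U - trace_inner D V"
      if "U \<in> carrier_mat d d" "V \<in> carrier_mat d d" for U V
      using trace_inner_diff_left[of U d V D] that DC
      by (simp add: trace_inner_commute[of D d d] minus_carrier_mat)
    show "trace_inner D (D * Y) = trace_inner D (Y * Y) - trace_inner D (Z * Y)"
      using sub[of "Y * Y" "Z * Y"] YC ZC minus_mult_distrib_mat[of Y d d Z Y d] by (simp add: D_def)
    show "trace_inner D (D * Z) = trace_inner D (Y * Z) - trace_inner D (Z * Z)"
      using sub[of "Y * Z" "Z * Z"] YC ZC minus_mult_distrib_mat[of Y d d Z Z d] by (simp add: D_def)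
  qed
  \<comment> \<open>After expanding \<open>D\<close>, corresponding triple products agree up to a
    cyclic shift. So the cross terms cancel in the sum of the two equations
    \<open>YY\<close>.\<close>
  have "trace_inner D (Y * Z) = trace_inner D (Z * Y)"
    unfolding D_def using YC ZC
    by (simp add: trace_inner_diff_left[of _ d] trace_inner_cyclic[of Y d Y Z]
        trace_inner_cyclic[of Z d Y Z] trace_inner_cyclic[of Z d Z Y])
  then have "trace_inner (D * D) Y + trace_inner (D * D) Z = 0"
    using YY eq DC YC ZC by (simp add: trace_inner_assoc flip: D_def)
  moreover have "0 \<le> trace_inner (D * D) Y" "0 \<le> trace_inner (D * D) Z"
    using trace_inner_psd DD Y Z by blast+
  ultimately have "trace_inner (D * D) Y = 0" "trace_inner (D * D) Z = 0" by linarith+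
  then have "(D * D) * Y = 0\<^sub>m d d" "(D * D) * Z = 0\<^sub>m d d"
    using trace_inner_psd_eq_0D DD Y Z by blast+
  \<comment> \<open>Subtracting the two products gives \<open>D^3 = 0\<close>. Hence
    \<open>D^4\<close> has trace 0, so the symmetric matrix \<open>D * D\<close> is 0, and then so
    is \<open>D\<close>.\<close>
  then have "(D * D) * D = 0\<^sub>m d d"
    using mult_minus_distrib_mat[of "D * D" d d Y d Z] DC YC ZC by (simp flip: D_def)
  then have "trace_inner (D * D) (D * D) = 0"
    using DC by (simp add: trace_inner_zero flip: trace_inner_assoc[of "D * D" d D D])
  then have "D * D = 0\<^sub>m d d" by (rule trace_inner_self_eq_0D[OF psd_mats_sym[OF DD]])
  then have "trace_inner D D = 0" by (simp add: trace_inner_def mat_trace_def)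
  then have "D = 0\<^sub>m d d" by (rule trace_inner_self_eq_0D[OF D])
  have "Y $$ (a, b) = Z $$ (a, b)" if "a < d" "b < d" for a b
    using arg_cong[OF \<open>D = 0\<^sub>m d d\<close>, of "\<lambda>U. U $$ (a, b)"] that YC ZC by (simp add: D_def)
  then show ?thesis using YC ZC by (auto intro!: eq_matI)
qed

lemma extreme_ray_dnn_cpsd_imp_cp:
  assumes ext: "extreme_ray (dnn_mats n) R" and AR: "A \<in> R" and cpsd: "A \<in> cpsd_mats n"
  shows "A \<in> cp_mats n"
proof -
  have A: "A \<in> sym_mats n" using cpsd by (simp add: cpsd_mats_def)
  note AC = sym_matsD[OF A]
  obtain d X where X: "\<And>i. i < n \<Longrightarrow> X i \<in> psd_mats d"
    and gram: "\<And>i j. i < n \<Longrightarrow> j < n \<Longrightarrow> A $$ (i, j) = trace_inner (X i) (X j)"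
    using cpsd unfolding cpsd_mats_def by blast
  note XC = sym_matsD[OF psd_mats_sym[OF X]]
  have Anonneg: "0 \<le> A $$ (i, j)" if "i < n" "j < n" for i j
    using that gram trace_inner_psd[OF X X] by simp
  have rank1: "A $$ (i, j) = sqrt (A $$ (i, i)) * sqrt (A $$ (j, j))" if ij: "i < n" "j < n" for i j
  proof (cases "A = 0\<^sub>m n n \<or> A $$ (j, j) = 0")
    case True
    \<comment> \<open>Degenerate case: \<open>X j\<close> has norm 0, so both sides are 0.\<close>
    then have Ajj: "A $$ (j, j) = 0" using ij by auto
    then have "X j = 0\<^sub>m d d"
      using gram[OF ij(2) ij(2)] by (intro trace_inner_self_eq_0D psd_mats_sym X ij) auto
    then have "A $$ (i, j) = 0" using gram[OF ij] XC(1)[OF ij(1)] by (simp add: trace_inner_zero)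
    then show ?thesis using Ajj by simp
  next
    case False
    define \<alpha> where "\<alpha> = sqrt (A $$ (j, j))"
    define \<beta> where "\<beta> = sqrt (A $$ (i, i))"
    have sq: "\<alpha> * \<alpha> = A $$ (j, j)" "\<beta> * \<beta> = A $$ (i, i)" and nn: "0 \<le> \<alpha>" "0 \<le> \<beta>"
      using Anonneg ij by (auto simp: \<alpha>_def \<beta>_def)
    note Xi = XC(1)[OF ij(1)] and Xj = XC(1)[OF ij(2)]
    \<comment> \<open>The multiplier is the difference of the two matrices to be shown equal, which
      is the shape that \<open>psd_eq_of_trace_squares\<close> asks for.\<close>
    define P where "P = \<alpha> \<cdot>\<^sub>m X i - \<beta> \<cdot>\<^sub>m X j"
    have P: "P \<in> carrier_mat d d" using Xi Xj by (simp add: P_def minus_carrier_mat)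
    obtain t where t: "\<And>i j. i < n \<Longrightarrow> j < n \<Longrightarrow>
        trace_inner P (X i * X j) + trace_inner P (X j * X i) = t * A $$ (i, j)"
      using extreme_ray_dnn_gram_products[OF ext AR _ AC(1) X gram P] False by blast
    have sm: "trace_inner P ((c \<cdot>\<^sub>m U) * (c \<cdot>\<^sub>m U)) = c * c * trace_inner P (U * U)"
      if "U \<in> carrier_mat d d" for c U
      using that P by (simp add: mult_smult_distrib[of _ d d _ d] mult_smult_assoc_mat[of _ d d _ d]
          trace_inner_smult_right[of _ d])
    have "\<alpha> \<cdot>\<^sub>m X i = \<beta> \<cdot>\<^sub>m X j"
    proof (rule psd_eq_of_trace_squares)
      show "\<alpha> \<cdot>\<^sub>m X i \<in> psd_mats d" "\<beta> \<cdot>\<^sub>m X j \<in> psd_mats d"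
        using X ij nn by (auto intro: psd_mats_smult)
      show "trace_inner (\<alpha> \<cdot>\<^sub>m X i - \<beta> \<cdot>\<^sub>m X j) (\<alpha> \<cdot>\<^sub>m X i * (\<alpha> \<cdot>\<^sub>m X i))
          = trace_inner (\<alpha> \<cdot>\<^sub>m X i - \<beta> \<cdot>\<^sub>m X j) (\<beta> \<cdot>\<^sub>m X j * (\<beta> \<cdot>\<^sub>m X j))"
      proof -
        \<comment> \<open>On the diagonal the two symmetrised traces coincide. Scaling by \<alpha>
          squared, which is \<open>A $$ (j, j)\<close>, and \<beta> squared, which is
          \<open>A $$ (i, i)\<close>, then equalises the two sides.\<close>
        have half: "trace_inner P (X i * X i) = t / 2 * A $$ (i, i)"
          "trace_inner P (X j * X j) = t / 2 * A $$ (j, j)"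
          using t[OF ij(1) ij(1)] t[OF ij(2) ij(2)] by simp_all
        have "\<alpha> * \<alpha> * trace_inner P (X i * X i) = \<beta> * \<beta> * trace_inner P (X j * X j)"
          unfolding sq half by simp
        then show ?thesis unfolding P_def[symmetric] sm[OF Xi] sm[OF Xj] .
      qed
    qed
    \<comment> \<open>Pair both sides with \<open>X j\<close>; the nonzero factor \<alpha> is
      cancelled afterwards.\<close>
    then have "\<alpha> * A $$ (i, j) = \<beta> * A $$ (j, j)"
      using trace_inner_smult_left[OF Xi Xj, of \<alpha>] trace_inner_smult_left[OF Xj Xj, of \<beta>] gram ij by simp
    then have "\<alpha> * A $$ (i, j) = \<alpha> * (\<beta> * \<alpha>)"
      unfolding sq(1)[symmetric] by (simp only: mult.left_commute)
    moreover have "\<alpha> \<noteq> 0" using False by (simp add: \<alpha>_def)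
    ultimately show ?thesis by (simp add: \<alpha>_def \<beta>_def)
  qed
  \<comment> \<open>By \<open>rank1\<close>, nonnegative vectors of length 1 already represent
    \<open>A\<close>.\<close>
  define x where "x i = vec 1 (\<lambda>_. sqrt (A $$ (i, i)))" for i
  have "x i \<bullet> x j = sqrt (A $$ (i, i)) * sqrt (A $$ (j, j))" for i j
    by (simp add: x_def scalar_prod_def)
  then have "A $$ (i, j) = x i \<bullet> x j" if "i < n" "j < n" for i j
    by (metis rank1 that)
  moreover have "x i \<in> carrier_vec 1 \<and> (\<forall>k<1. 0 \<le> x i $ k)" if "i < n" for i
    using Anonneg[OF that that] by (simp add: x_def)
  ultimately show ?thesis unfolding cp_mats_def using A by blast
qed

theorem lemma3p10:
  shows "(\<forall>n::nat. \<forall>A::real mat.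
            5 \<le> n \<longrightarrow> odd n \<longrightarrow> A \<in> sym_mats n \<longrightarrow>
            is_cycle_graph n (support_edges A) \<longrightarrow> vec_space.rank n A = n - 2 \<longrightarrow>
            A \<notin> cpsd_mats n)
       \<and> (\<forall>A::real mat. \<forall>R.
            A \<in> sym_mats 5 \<longrightarrow> extreme_ray (dnn_mats 5) R \<longrightarrow> A \<in> R \<longrightarrow>
            (A \<in> cpsd_mats 5 \<longleftrightarrow> A \<in> cp_mats 5))"
proof (intro conjI allI impI)
  fix n :: nat and A :: "real mat"
  assume "5 \<le> n" "A \<in> sym_mats n" "is_cycle_graph n (support_edges A)" "vec_space.rank n A = n - 2"
  then show "A \<notin> cpsd_mats n" by (intro cycle_rank_not_cpsd) auto
next
  fix A :: "real mat" and R
  assume "extreme_ray (dnn_mats 5) R" "A \<in> R"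
  then show "A \<in> cpsd_mats 5 \<longleftrightarrow> A \<in> cp_mats 5"
    using extreme_ray_dnn_cpsd_imp_cp[of 5 R A] subsetD[OF cp_mats_subset_cpsd_mats] by metis
qed

end
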